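(* Let $\mathbf I=([0,1],d)$, where $d(x,y)=|x-y|$ is the Euclidean metric, and let $\mathfrak I_2=([0,1],d_2^* )$, where $d_2^*$ is the metric obtained from the $L$-$R$ symbol sequences of the 2-tent map (defined in the context). Then $\mathfrak I_2$ is an ultracontinuum of $\mathbf I$.
   Context: A continuum is a compact, connected metric space with uncountably many elements. $(X,d^* )$ is an ultracontinuum of $(X,d)$ if and only if $(X,d)$ is a continuum and the metric topology of $(X,d^* )$ is strictly finer than the metric topology of $(X,d)$. The 2-tent map $f_2:[0,1]\to[0,1]$ is $f_2(x)=2x$ if $0\le x<\frac12$ and $f_2(x)=2(1-x)$ if $\frac12\le x\le1$. $Q_2$ is the set of itineraries of points of $[0,1]$ under $f_2$: the itinerary of $x$ is the infinite sequence over $\{L,R\}$ whose $n$th symbol is $L$ if $f_2^{n-1}(x)\in[0,\frac12)$ and $R$ if $f_2^{n-1}(x)\in[\frac12,1]$. Equivalently, $Q_2$ is the set of all infinite one-sided sequences over $\{L,R\}$ that do not have $LRLLLL\dots$ as a suffix. The metric $\ell$ on $Q_2$ is $\ell(x,y)=2^{-k}$ if $x\ne y$, where $k$ is the length of the longest prefix shared by $x$ and $y$, and $\ell(x,x)=0$. The bijection $h_2:Q_2\to[0,1]$ sends a sequence $s_1s_2s_3\dots$ to the number whose itinerary it is; explicitly, $h_2(s_1s_2s_3\dots)=\sum_{i\ge1}\chi_i2^{-i}$, where $\chi_i\in\{0,1\}$ is the parity of the number of $R$'s among $s_1,\dots,s_i$. The metric $d_2^*$ on $[0,1]$ is $d_2^*(x,y)=\ell(h_2^{-1}(x),h_2^{-1}(y))$.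 *)

theory Defs
  imports "HOL-Analysis.Analysis"
begin

definition continuum :: "'a set \<Rightarrow> ('a \<Rightarrow> 'a \<Rightarrow> real) \<Rightarrow> bool" where
  "continuum X d \<longleftrightarrow> Metric_space X d
     \<and> compact_space (Metric_space.mtopology X d)
     \<and> connected_space (Metric_space.mtopology X d)
     \<and> uncountable X"

definition strictly_finer :: "'a topology \<Rightarrow> 'a topology \<Rightarrow> bool" where
  "strictly_finer S T \<longleftrightarrow> topspace S = topspace T \<and> {U. openin T U} \<subset> {U. openin S U}"

(* ultracontinuum X d' d: (X,d') is an ultracontinuum of (X,d). *)
definition ultracontinuum :: "'a set \<Rightarrow> ('a \<Rightarrow> 'a \<Rightarrow> real) \<Rightarrow> ('a \<Rightarrow> 'a \<Rightarrow> real) \<Rightarrow> bool" where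
  "ultracontinuum X d' d \<longleftrightarrow> Metric_space X d' \<and> continuum X d
     \<and> strictly_finer (Metric_space.mtopology X d') (Metric_space.mtopology X d)"

datatype LR = L | R

definition tent2 :: "real \<Rightarrow> real" where
  "tent2 x = (if x < 1/2 then 2 * x else 2 * (1 - x))"

(* Sequences are indexed from 0, so the symbol at n belongs to the n-th iterate. Only
   arguments in {0..1} are meaningful; for them all iterates stay in {0..1}
   (funpow_tent2_in_unit), so R means that the iterate lies in {1/2..1}. *)
definition itinerary2 :: "real \<Rightarrow> nat \<Rightarrow> LR" where
  "itinerary2 x n = (if (tent2 ^^ n) x \<in> {0..<1/2} then L else R)"

definition Q2 :: "(nat \<Rightarrow> LR) set" where
  "Q2 = itinerary2 ` {0..1}"

(* For distinct s and t the GREATEST exists: it is the length of their longest common prefix. *)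
definition seq_dist :: "(nat \<Rightarrow> LR) \<Rightarrow> (nat \<Rightarrow> LR) \<Rightarrow> real" where
  "seq_dist s t = (if s = t then 0 else (1/2) ^ (GREATEST k. \<forall>i<k. s i = t i))"

(* The number in {0..1} whose itinerary is s; meaningful for s in Q2, by inj_on_itinerary2. *)
definition h2 :: "(nat \<Rightarrow> LR) \<Rightarrow> real" where
  "h2 s = (THE x. x \<in> {0..1} \<and> itinerary2 x = s)"

definition d2_star :: "real \<Rightarrow> real \<Rightarrow> real" where
  "d2_star x y = seq_dist (the_inv_into Q2 h2 x) (the_inv_into Q2 h2 y)"

lemma tent2_in_unit: "x \<in> {0..1} \<Longrightarrow> tent2 x \<in> {0..1}"
  by (auto simp: tent2_def)

lemma funpow_tent2_in_unit: "x \<in> {0..1} \<Longrightarrow> (tent2 ^^ n) x \<in> {0..1}"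
  by (induction n) (use tent2_in_unit in auto)

lemma inj_on_itinerary2: "inj_on itinerary2 {0..1}"
proof (rule inj_onI)
  fix x y :: real
  assume x: "x \<in> {0..1}" and y: "y \<in> {0..1}" and eq: "itinerary2 x = itinerary2 y"
  have expand: "\<bar>(tent2 ^^ n) x - (tent2 ^^ n) y\<bar> = 2 ^ n * \<bar>x - y\<bar>" for n
  proof (induction n)
    case (Suc n)
    have "itinerary2 x n = itinerary2 y n" using eq by simp
    then have "(tent2 ^^ n) x < 1/2 \<longleftrightarrow> (tent2 ^^ n) y < 1/2"
      using funpow_tent2_in_unit[OF x, of n] funpow_tent2_in_unit[OF y, of n]
      by (auto simp: itinerary2_def split: if_splits)
    then have "\<bar>tent2 ((tent2 ^^ n) x) - tent2 ((tent2 ^^ n) y)\<bar>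
        = 2 * \<bar>(tent2 ^^ n) x - (tent2 ^^ n) y\<bar>"
      by (auto simp: tent2_def abs_if)
    then show ?case using Suc by simp
  qed simp
  show "x = y"
  proof (rule ccontr)
    assume "x \<noteq> y"
    then obtain n where "1 / \<bar>x - y\<bar> < 2 ^ n"
      using real_arch_pow[of 2 "1 / \<bar>x - y\<bar>"] by auto
    then have "1 < 2 ^ n * \<bar>x - y\<bar>"
      using \<open>x \<noteq> y\<close> by (simp add: divide_less_eq)
    moreover have "\<bar>(tent2 ^^ n) x - (tent2 ^^ n) y\<bar> \<le> 1"
      using funpow_tent2_in_unit[OF x, of n] funpow_tent2_in_unit[OF y, of n] by auto
    ultimately show False using expand[of n] by simp
  qed
qed

lemma h2_itinerary2: "x \<in> {0..1} \<Longrightarrow> h2 (itinerary2 x) = x"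
  unfolding h2_def by (rule the_equality) (auto intro: inj_onD[OF inj_on_itinerary2])

lemma bij_betw_h2: "bij_betw h2 Q2 {0..1}"
  unfolding bij_betw_def inj_on_def Q2_def
  by (auto simp: h2_itinerary2 image_image)

end

theory Submission
  imports Defs
begin

text \<open>
  While the orbits of two points carry the same symbols, the tent map doubles their distance; so
  points whose itineraries share a prefix of length \<open>n\<close> are at Euclidean distance at most
  \<open>2\<^sup>-\<^sup>n\<close>, that is, the symbolic metric dominates the Euclidean one. Strictness is witnessed by
  the interval from \<open>1/2\<close> to \<open>1\<close>, the set of points whose itinerary starts with \<open>R\<close>.
\<close>

text \<open>Replaces the \<open>GREATEST\<close> in \<open>seq_dist\<close> by the first index of
  disagreement: with indices starting at 0, that index equals the length of the longest common
  prefix.\<close>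

lemma seq_dist_cases:
  obtains "s = t" "seq_dist s t = 0"
  | n where "seq_dist s t = (1/2) ^ n" "\<And>i. i < n \<Longrightarrow> s i = t i" "s n \<noteq> t n"
proof (cases "s = t")
  case False
  then have ex: "\<exists>i. s i \<noteq> t i"
    by auto
  define n where "n = (LEAST i. s i \<noteq> t i)"
  have neq: "s n \<noteq> t n"
    unfolding n_def by (rule LeastI_ex[OF ex])
  have eq: "s i = t i" if "i < n" for i
    using not_less_Least[OF that[unfolded n_def]] by simp
  have "(GREATEST k. \<forall>i<k. s i = t i) = n"
  proof (rule Greatest_equality)
    show "k \<le> n" if "\<forall>i<k. s i = t i" for k
      using that neq by (meson not_le)
  qed (use eq in blast)
  then have "seq_dist s t = (1/2) ^ n"
    using False by (simp add: seq_dist_def)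
  then show thesis
    using eq neq by (rule that(2))
qed (rule that(1), simp_all add: seq_dist_def)

text \<open>If the first disagreement is at \<open>m\<close>, both sides say
  \<open>n \<le> m\<close>, since powers of 1/2 decrease. Closed balls of these radii are thus
  cylinder sets.\<close>

lemma seq_dist_le_iff: "seq_dist s t \<le> (1/2) ^ n \<longleftrightarrow> (\<forall>i<n. s i = t i)"
proof (cases rule: seq_dist_cases[of s t])
  case (2 m)
  have "seq_dist s t \<le> (1/2) ^ n \<longleftrightarrow> n \<le> m"
    by (simp add: 2(1) power_decreasing_iff)
  also have "\<dots> \<longleftrightarrow> (\<forall>i<n. s i = t i)"
    using 2(2,3) by (meson less_le_trans not_le)
  finally show ?thesis .
qed simp

lemma seq_dist_nonneg: "0 \<le> seq_dist s t"
  by (simp add: seq_dist_def)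

lemma seq_dist_commute: "seq_dist s t = seq_dist t s"
  by (simp add: seq_dist_def eq_commute)

lemma seq_dist_eq_0_iff: "seq_dist s t = 0 \<longleftrightarrow> s = t"
  by (simp add: seq_dist_def)

text \<open>Agreement on the first \<open>n\<close> symbols is transitive.\<close>

lemma seq_dist_ultrametric: "seq_dist s u \<le> max (seq_dist s t) (seq_dist t u)"
proof -
  define r where "r = max (seq_dist s t) (seq_dist t u)"
  have le: "seq_dist s t \<le> r" "seq_dist t u \<le> r"
    by (auto simp: r_def)
  \<comment> \<open>The maximum is itself one of the two distances, so it has the form that
    \<open>seq_dist_le_iff\<close> requires of a bound.\<close>
  have "r = 0 \<or> (\<exists>n. r = (1/2) ^ n)"
    unfolding r_def max_def
    by (cases s t rule: seq_dist_cases; cases t u rule: seq_dist_cases) auto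
  then have "seq_dist s u \<le> r"
  proof
    assume "r = 0"
    then show ?thesis
      using le by (metis order_antisym seq_dist_eq_0_iff seq_dist_nonneg)
  next
    assume "\<exists>n. r = (1/2) ^ n"
    then show ?thesis
      using le by (auto simp: seq_dist_le_iff)
  qed
  then show ?thesis
    by (simp add: r_def)
qed

text \<open>On the unit interval \<open>itinerary2\<close> is the inverse of \<open>h2\<close>, so
  \<open>d2_star\<close> is the pullback of \<open>seq_dist\<close> along an injective map.\<close>

lemma d2_star_eq:
  assumes "x \<in> {0..1}" "y \<in> {0..1}"
  shows "d2_star x y = seq_dist (itinerary2 x) (itinerary2 y)"
proof -
  have "the_inv_into Q2 h2 z = itinerary2 z" if "z \<in> {0..1}" for z
    using that bij_betw_h2
    by (intro the_inv_into_f_eq) (auto simp: h2_itinerary2 Q2_def bij_betw_def)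
  then show ?thesis
    using assms by (simp add: d2_star_def)
qed

lemma Metric_space_d2_star: "Metric_space {0..1} d2_star"
proof
  fix x y z :: real
  show "0 \<le> d2_star x y"
    by (simp add: d2_star_def seq_dist_nonneg)
  show "d2_star x y = d2_star y x"
    unfolding d2_star_def by (rule seq_dist_commute)
  assume xy: "x \<in> {0..1}" "y \<in> {0..1}"
  then show "d2_star x y = 0 \<longleftrightarrow> x = y"
    by (auto simp: d2_star_eq seq_dist_eq_0_iff dest: inj_onD[OF inj_on_itinerary2])
  assume "z \<in> {0..1}"
  then show "d2_star x z \<le> d2_star x y + d2_star y z"
    using xy seq_dist_ultrametric[of "itinerary2 x" "itinerary2 z" "itinerary2 y"]
      seq_dist_nonneg[of "itinerary2 x" "itinerary2 y"]
      seq_dist_nonneg[of "itinerary2 y" "itinerary2 z"]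
    by (simp add: d2_star_eq)
qed

text \<open>Iterates never become negative, so a symbol depends only on the comparison with
  1/2.\<close>

lemma itinerary2_eq_iff:
  assumes "x \<in> {0..1}" "y \<in> {0..1}"
  shows "itinerary2 x n = itinerary2 y n \<longleftrightarrow> ((tent2 ^^ n) x < 1/2 \<longleftrightarrow> (tent2 ^^ n) y < 1/2)"
  using funpow_tent2_in_unit[OF assms(1), of n] funpow_tent2_in_unit[OF assms(2), of n]
  by (auto simp: itinerary2_def)

text \<open>Equal symbols put both iterates on the same branch of \<open>tent2\<close>, which is
  affine of slope 2 or -2.\<close>

lemma funpow_tent2_expand:
  assumes "x \<in> {0..1}" "y \<in> {0..1}" "\<And>i. i < n \<Longrightarrow> itinerary2 x i = itinerary2 y i"
  shows "\<bar>(tent2 ^^ n) x - (tent2 ^^ n) y\<bar> = 2 ^ n * \<bar>x - y\<bar>"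
  using assms(3)
proof (induction n)
  case (Suc n)
  have "(tent2 ^^ n) x < 1/2 \<longleftrightarrow> (tent2 ^^ n) y < 1/2"
    using Suc.prems[of n] assms by (simp add: itinerary2_eq_iff)
  then have "\<bar>tent2 ((tent2 ^^ n) x) - tent2 ((tent2 ^^ n) y)\<bar>
      = 2 * \<bar>(tent2 ^^ n) x - (tent2 ^^ n) y\<bar>"
    by (auto simp: tent2_def abs_if)
  then show ?case
    using Suc by simp
qed simp

lemma abs_diff_le_d2_star:
  assumes "x \<in> {0..1}" "y \<in> {0..1}"
  shows "\<bar>x - y\<bar> \<le> d2_star x y"
proof (cases rule: seq_dist_cases[of "itinerary2 x" "itinerary2 y"])
  case 1
  then show ?thesis
    using assms inj_onD[OF inj_on_itinerary2] by (auto simp: d2_star_eq)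
next
  case (2 n)
  have "2 ^ n * \<bar>x - y\<bar> = \<bar>(tent2 ^^ n) x - (tent2 ^^ n) y\<bar>"
    using funpow_tent2_expand[OF assms] 2(2) by simp
  \<comment> \<open>Both orbits stay in the unit interval, which has diameter 1.\<close>
  also have "\<dots> \<le> 1"
    using funpow_tent2_in_unit[OF assms(1), of n] funpow_tent2_in_unit[OF assms(2), of n] by auto
  finally have "\<bar>x - y\<bar> \<le> (1/2) ^ n"
    by (simp add: power_one_over field_simps)
  then show ?thesis
    using assms 2(1) by (simp add: d2_star_eq)
qed

lemma Metric_space_abs_diff: "Metric_space A (\<lambda>x y. \<bar>x - y\<bar> :: real)"
  by unfold_locales auto

text \<open>Makes the usual compactness and connectedness results for real intervals
  applicable.\<close>

lemma mtopology_abs_diff: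
  "Metric_space.mtopology A (\<lambda>x y. \<bar>x - y\<bar> :: real) = top_of_set A"
proof -
  interpret Submetric UNIV dist A
    by unfold_locales auto
  have "(dist :: real \<Rightarrow> real \<Rightarrow> real) = (\<lambda>x y. \<bar>x - y\<bar>)"
    by (auto simp: dist_real_def fun_eq_iff)
  then show ?thesis
    using mtopology_submetric by simp
qed

lemma continuum_unit_interval: "continuum {0..1} (\<lambda>x y. \<bar>x - y\<bar> :: real)"
  unfolding continuum_def mtopology_abs_diff
  by (simp add: Metric_space_abs_diff compact_space_subtopology connected_space_subtopology
      uncountable_closed_interval)

text \<open>The larger metric has the smaller balls.\<close>

lemma openin_mtopology_mono:
  assumes "Metric_space M d" "Metric_space M d'"
    and "\<And>x y. x \<in> M \<Longrightarrow> y \<in> M \<Longrightarrow> d x y \<le> d' x y"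
    and "openin (Metric_space.mtopology M d) U"
  shows "openin (Metric_space.mtopology M d') U"
proof -
  have "Metric_space.mball M d' x r \<subseteq> Metric_space.mball M d x r" for x r
    using assms(3) by (force simp: Metric_space.in_mball[OF assms(1)] Metric_space.in_mball[OF assms(2)])
  then show ?thesis
    using assms(4) unfolding Metric_space.openin_mtopology[OF assms(1)]
      Metric_space.openin_mtopology[OF assms(2)]
    by (meson order_trans)
qed

lemma openin_d2_star_right_half: "openin (Metric_space.mtopology {0..1} d2_star) {1/2..1}"
proof -
  interpret Metric_space "{0..1}" d2_star
    by (rule Metric_space_d2_star)
  \<comment> \<open>Radius 1 is \<open>(1/2) ^ 0\<close>, the distance of sequences that differ in
    their first symbol; the open ball excludes those.\<close>
  have "mball x 1 \<subseteq> {1/2..1}" if "x \<in> {1/2..1}" for x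
  proof
    fix y
    assume "y \<in> mball x 1"
    then have xy: "x \<in> {0..1}" "y \<in> {0..1}" "d2_star x y < 1"
      by auto
    then have "itinerary2 x 0 = itinerary2 y 0"
    proof (cases rule: seq_dist_cases[of "itinerary2 x" "itinerary2 y"])
      case (2 n)
      have "n \<noteq> 0"
        using xy 2(1) by (intro notI) (simp add: d2_star_eq)
      then show ?thesis
        by (intro 2(2)) simp
    qed simp
    then show "y \<in> {1/2..1}"
      using xy that itinerary2_eq_iff[of x y 0] by auto
  qed
  then show ?thesis
    unfolding openin_mtopology by (auto intro!: exI[of _ 1])
qed

text \<open>Being closed, the half interval would otherwise be a nontrivial clopen subset of a
  connected space.\<close>

lemma not_openin_right_half: "\<not> openin (top_of_set {0..1}) {1/2..1::real}"
proof
  assume "openin (top_of_set {0..1}) {1/2..1::real}"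
  moreover have "closedin (top_of_set {0..1}) {1/2..1::real}"
    by (auto intro: closed_subset)
  ultimately have "{1/2..1::real} = {} \<or> {1/2..1::real} = {0..1}"
    using connected_clopen[of "{0..1::real}"] by auto
  then show False
    by auto
qed

theorem theorem4: "ultracontinuum {0..1::real} d2_star (\<lambda>x y. \<bar>x - y\<bar>)"
proof -
  have "openin (Metric_space.mtopology {0..1} d2_star) U"
    if "openin (Metric_space.mtopology {0..1} (\<lambda>x y. \<bar>x - y\<bar>)) U" for U :: "real set"
    using openin_mtopology_mono[OF Metric_space_abs_diff Metric_space_d2_star abs_diff_le_d2_star that] .
  moreover have "\<not> openin (Metric_space.mtopology {0..1} (\<lambda>x y. \<bar>x - y\<bar>)) {1/2..1::real}"
    by (simp add: mtopology_abs_diff not_openin_right_half)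
  ultimately have "strictly_finer (Metric_space.mtopology {0..1} d2_star)
      (Metric_space.mtopology {0..1} (\<lambda>x y. \<bar>x - y\<bar>))"
    unfolding strictly_finer_def
    using openin_d2_star_right_half
    by (auto simp: Metric_space.topspace_mtopology[OF Metric_space_d2_star]
        Metric_space.topspace_mtopology[OF Metric_space_abs_diff])
  then show ?thesis
    by (simp add: ultracontinuum_def Metric_space_d2_star continuum_unit_interval)
qed

end
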